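(* Let $Y$ be a random variable whose moment generating function $E[e^{tY}]$ exists for $|t|<r$, for some $r>0$. Define $T^{Y}(n,k)$ by $\frac{1}{k!}\big(E[e^{\frac{Y}{2}t}]-E[e^{-\frac{Y}{2}t}]\big)^{k}=\sum_{n=k}^{\infty}T^{Y}(n,k)\frac{t^{n}}{n!}$ $(k\ge0)$, and $B_{n}^{(c,Y)}(x)=\sum_{k=0}^{n}T^{Y}(n,k)x^{k}$. Then for all $n\ge0$ and $k\ge 1$, $$\Big(\frac{d}{dx}\Big)^{k}B_{n}^{(c,Y)}(x)= k!\sum_{j=0}^{n-k}\binom{n}{j}B_{j}^{(c,Y)}(x)T^{Y}(n-j,k),$$ where the sum is empty (zero) if $n<k$. *)

theory Defs
  imports "HOL-Probability.Probability"
begin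

definition mgf_exists :: "'a measure \<Rightarrow> ('a \<Rightarrow> real) \<Rightarrow> real \<Rightarrow> bool" where
  "mgf_exists M Y r \<longleftrightarrow> (\<forall>t. \<bar>t\<bar> < r \<longrightarrow> integrable M (\<lambda>\<omega>. exp (t * Y \<omega>)))"

definition central_gf :: "'a measure \<Rightarrow> ('a \<Rightarrow> real) \<Rightarrow> nat \<Rightarrow> real \<Rightarrow> real" where
  "central_gf M Y k t = 1 / fact k *
     (prob_space.expectation M (\<lambda>\<omega>. exp (Y \<omega> / 2 * t)) -
      prob_space.expectation M (\<lambda>\<omega>. exp (- (Y \<omega> / 2) * t))) ^ k"

text \<open>The numbers $T^Y(n,k)$ are the coefficients in
  $\frac{1}{k!}(E[e^{Yt/2}] - E[e^{-Yt/2}])^k = \sum_{n \ge k} T^Y(n,k) t^n/n!$, an identity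
  of functions of $t$ near $0$. They are totalised by $T^Y(n,k) = 0$ for $n < k$, so that the sum
  may be written as one over all $n$. The lemma \<open>central_fact_generating\<close> below shows that the
  description is satisfied whenever the moment generating function exists near $0$.\<close>

definition central_fact :: "'a measure \<Rightarrow> ('a \<Rightarrow> real) \<Rightarrow> nat \<Rightarrow> nat \<Rightarrow> real" where
  "central_fact M Y n k =
     (THE a. (\<forall>m<k. a m = 0) \<and>
             (\<forall>\<^sub>F t in nhds 0. (\<lambda>m. a m * (t ^ m / fact m)) sums central_gf M Y k t)) n"

definition central_bell :: "'a measure \<Rightarrow> ('a \<Rightarrow> real) \<Rightarrow> nat \<Rightarrow> real \<Rightarrow> real" where
  "central_bell M Y n x = (\<Sum>k=0..n. central_fact M Y n k * x ^ k)"

lemma powser_sums_0_imp_coeff_0: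
  fixes c :: "nat \<Rightarrow> real"
  assumes ev: "\<forall>\<^sub>F t in nhds 0. (\<lambda>n. c n * t ^ n) sums 0"
  shows "c n = 0"
proof (induction n rule: less_induct)
  case (less n)
  obtain d where d: "d > 0" "\<And>t. \<bar>t\<bar> < d \<Longrightarrow> (\<lambda>n. c n * t ^ n) sums 0"
    using ev by (auto simp: eventually_nhds_metric)
  have "(\<lambda>i. c (i + n) * t ^ i) sums 0" if "t \<noteq> 0" "norm t < d" for t
  proof -
    have "(\<lambda>i. c (i + n) * t ^ (i + n)) sums (0 - (\<Sum>i<n. c i * t ^ i))"
      using d(2)[of t] that by (intro sums_split_initial_segment) auto
    also have "(\<Sum>i<n. c i * t ^ i) = 0" using less by (intro sum.neutral) auto
    finally have "(\<lambda>i. t ^ n * (c (i + n) * t ^ i)) sums (t ^ n * 0)"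
      by (simp add: power_add mult_ac)
    thus ?thesis using that by (subst (asm) sums_mult_iff) auto
  qed
  hence "((\<lambda>_. 0) \<longlongrightarrow> c (0 + n)) (at (0 :: real))"
    by (rule powser_limit_0_strong[OF d(1)])
  thus ?case using tendsto_const_iff[of "at (0::real)" 0 "c n"] by simp
qed

lemma mgf_sums:
  fixes X :: "'a \<Rightarrow> real"
  assumes X[measurable]: "X \<in> borel_measurable M" and "mgf_exists M X s" and "\<bar>t\<bar> < s"
  shows "(\<lambda>n. (\<integral>\<omega>. X \<omega> ^ n \<partial>M) / fact n * t ^ n) sums (\<integral>\<omega>. exp (X \<omega> * t) \<partial>M)"
proof -
  let ?f = "\<lambda>n \<omega>. (X \<omega> * t) ^ n / fact n"
  let ?w = "\<lambda>\<omega>. exp (t * X \<omega>) + exp ((- t) * X \<omega>)"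
  have w: "integrable M ?w"
    using assms(2,3) unfolding mgf_exists_def
    by (intro Bochner_Integration.integrable_add) (metis abs_minus_cancel)+
  have e: "(\<lambda>n. y ^ n / fact n) sums exp y" for y :: real
    using exp_converges[of y] by (simp add: divide_inverse mult.commute)
  have bnd: "\<bar>\<Sum>n<j. ?f n \<omega>\<bar> \<le> ?w \<omega>" for j \<omega>
  proof -
    have "\<bar>\<Sum>n<j. ?f n \<omega>\<bar> \<le> (\<Sum>n<j. \<bar>X \<omega> * t\<bar> ^ n / fact n)"
      by (rule order_trans[OF sum_abs]) (simp add: power_abs)
    also have "\<dots> \<le> exp \<bar>X \<omega> * t\<bar>"
      unfolding sums_unique[OF e[of "\<bar>X \<omega> * t\<bar>"]]
      by (rule sum_le_suminf[OF sums_summable[OF e]]) auto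
    also have "\<dots> \<le> ?w \<omega>"
      by (cases "X \<omega> * t \<ge> 0") (auto simp: mult.commute abs_if)
    finally show ?thesis .
  qed
  have bnd1: "\<bar>?f n \<omega>\<bar> \<le> ?w \<omega> + ?w \<omega>" for n \<omega>
  proof -
    have "\<bar>?f n \<omega>\<bar> = \<bar>(\<Sum>i<Suc n. ?f i \<omega>) - (\<Sum>i<n. ?f i \<omega>)\<bar>" by simp
    also have "\<dots> \<le> ?w \<omega> + ?w \<omega>" 
      using bnd[where j = "Suc n" and \<omega> = \<omega>] bnd[where j = n and \<omega> = \<omega>] by linarith
    finally show ?thesis .
  qed
  have fi: "integrable M (?f n)" for n
    by (rule Bochner_Integration.integrable_bound[OF Bochner_Integration.integrable_add[OF w w]])
       (measurable, rule AE_I2, unfold real_norm_def, rule order_trans[OF bnd1 abs_ge_self])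
  have "(\<lambda>j. \<integral>\<omega>. (\<Sum>n<j. ?f n \<omega>) \<partial>M) \<longlonglongrightarrow> (\<integral>\<omega>. exp (X \<omega> * t) \<partial>M)"
    by (rule integral_dominated_convergence[where w = ?w])
       (measurable, rule w, rule AE_I2, rule e[unfolded sums_def],
        rule AE_I2, unfold real_norm_def, rule bnd)
  moreover have "(\<integral>\<omega>. (\<Sum>n<j. ?f n \<omega>) \<partial>M) = (\<Sum>n<j. (\<integral>\<omega>. X \<omega> ^ n \<partial>M) / fact n * t ^ n)" for j
    by (subst Bochner_Integration.integral_sum) (use fi in \<open>simp_all add: power_mult_distrib\<close>)
  ultimately show ?thesis by (simp add: sums_def)
qed

lemma mgf_has_fps_expansion:
  fixes X :: "'a \<Rightarrow> real"
  assumes X: "X \<in> borel_measurable M" and m: "mgf_exists M X s" and s: "s > 0"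
  shows "(\<lambda>t. \<integral>\<omega>. exp (X \<omega> * t) \<partial>M) has_fps_expansion Abs_fps (\<lambda>n. (\<integral>\<omega>. X \<omega> ^ n \<partial>M) / fact n)"
proof -
  let ?F = "Abs_fps (\<lambda>n. (\<integral>\<omega>. X \<omega> ^ n \<partial>M) / fact n)"
  have "0 < ereal (norm (s/2))"
    using s by simp
  also have "ereal (norm (s/2)) \<le> fps_conv_radius ?F"
    unfolding fps_conv_radius_def
    by (rule conv_radius_geI) (use mgf_sums[OF X m, of "s/2"] s in \<open>auto simp: sums_iff\<close>)
  finally have "fps_conv_radius ?F > 0" .
  moreover have "eventually (\<lambda>t. eval_fps ?F t = (\<integral>\<omega>. exp (X \<omega> * t) \<partial>M)) (nhds 0)"
  proof -
    have "eventually (\<lambda>t. t \<in> ball 0 s) (nhds (0::real))"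
      using s by (intro eventually_nhds_in_open) auto
    thus ?thesis
    proof eventually_elim
      case (elim t)
      thus ?case using mgf_sums[OF X m, of t] by (simp add: eval_fps_def sums_iff)
    qed
  qed
  ultimately show ?thesis by (simp add: has_fps_expansion_def)
qed

lemma central_fact_generating:
  fixes Y :: "'a \<Rightarrow> real"
  assumes "prob_space M" and Y: "Y \<in> borel_measurable M" and m: "mgf_exists M Y r" and r: "r > 0"
  shows "(\<forall>n<k. central_fact M Y n k = 0) \<and>
         (\<forall>\<^sub>F t in nhds 0. (\<lambda>n. central_fact M Y n k * (t ^ n / fact n)) sums central_gf M Y k t)"
proof -
  interpret prob_space M by fact
  let ?P = "\<lambda>a. (\<forall>m<k. a m = 0) \<and>
             (\<forall>\<^sub>F t in nhds 0. (\<lambda>m. a m * (t ^ m / fact m)) sums central_gf M Y k t)"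
  define F where "F c = Abs_fps (\<lambda>n. (\<integral>\<omega>. (c * Y \<omega>) ^ n \<partial>M) / fact n)" for c :: real
  have F: "(\<lambda>t. \<integral>\<omega>. exp ((c * Y \<omega>) * t) \<partial>M) has_fps_expansion F c" if "\<bar>c\<bar> = 1/2" for c
    unfolding F_def
  proof (rule mgf_has_fps_expansion[where s = r])
    show "mgf_exists M (\<lambda>\<omega>. c * Y \<omega>) r"
      unfolding mgf_exists_def
    proof (intro allI impI)
      fix t :: real assume "\<bar>t\<bar> < r"
      hence "\<bar>t * c\<bar> < r" unfolding abs_mult that by linarith
      thus "integrable M (\<lambda>\<omega>. exp (t * (c * Y \<omega>)))"
        using m unfolding mgf_exists_def by (simp add: mult.assoc[symmetric])
    qed
  qed (use Y r in auto)
  define G where "G = fps_const (1 / fact k) * (F (1/2) - F (-1/2)) ^ k"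
  have pow: "(\<lambda>t. f t ^ k) has_fps_expansion H ^ k"
    if "f has_fps_expansion H" for f :: "real \<Rightarrow> real" and H k
    by (induction k) (use that in \<open>auto intro: has_fps_expansion_mult\<close>)
  have "central_gf M Y k = (\<lambda>t. 1 / fact k * ((\<integral>\<omega>. exp ((1/2 * Y \<omega>) * t) \<partial>M) -
      (\<integral>\<omega>. exp ((-1/2 * Y \<omega>) * t) \<partial>M)) ^ k)"
    by (rule ext) (simp add: central_gf_def)
  hence G: "central_gf M Y k has_fps_expansion G"
    unfolding G_def
    by (simp only:)
       (intro has_fps_expansion_cmult_left pow has_fps_expansion_diff F; simp)
  define a where "a n = fact n * fps_nth G n" for n
  have ev: "\<forall>\<^sub>F t in nhds 0. (\<lambda>m. a m * (t ^ m / fact m)) sums central_gf M Y k t"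
  proof -
    have "eventually (\<lambda>t. t \<in> eball 0 (fps_conv_radius G)) (nhds 0)"
      using G by (intro eventually_nhds_in_open) (auto simp: has_fps_expansion_def zero_ereal_def)
    moreover have "eventually (\<lambda>t. eval_fps G t = central_gf M Y k t) (nhds 0)"
      using G by (simp add: has_fps_expansion_def)
    ultimately show ?thesis
    proof eventually_elim
      case (elim t)
      thus ?case using sums_eval_fps[of t G] by (simp add: a_def)
    qed
  qed
  have "fps_nth ((F (1/2) - F (-1/2)) ^ k) n = 0" if "n < k" for n
    using that by (intro startsby_zero_power_prefix[rule_format]) (auto simp: F_def prob_space)
  hence z: "\<forall>m<k. a m = 0" by (simp add: a_def G_def)
  have uniq: "b = a" if "?P b" for b
  proof
    fix n
    have "\<forall>\<^sub>F t in nhds 0. (\<lambda>m. b m * (t ^ m / fact m)) sums central_gf M Y k t"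
      using that by simp
    hence "\<forall>\<^sub>F t in nhds 0. (\<lambda>m. (b m - a m) / fact m * t ^ m) sums 0"
      using ev
    proof eventually_elim
      case (elim t)
      from sums_diff[OF this] show ?case
        by (simp add: diff_divide_distrib left_diff_distrib)
    qed
    from powser_sums_0_imp_coeff_0[OF this, of n] show "b n = a n" by simp
  qed
  have "(THE a. ?P a) = a" 
    by (rule the_equality) (use ev z in blast, rule uniq)
  hence "central_fact M Y n k = a n" for n by (simp add: central_fact_def)
  thus ?thesis using ev z by simp
qed

end

theory Submission
  imports Defs
begin

text \<open>
  The generating functions satisfy \<open>G\<^sub>l G\<^sub>k = ((l + k) choose k) G\<^sub>l\<^sub>+\<^sub>k\<close>, since both sides are
  multiples of the same power of \<open>E[e\<^sup>Y\<^sup>t\<^sup>/\<^sup>2] - E[e\<^sup>-\<^sup>Y\<^sup>t\<^sup>/\<^sup>2]\<close>. Comparing coefficients expresses the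
  binomial convolution of \<open>T(_, l)\<close> and \<open>T(_, k)\<close> through \<open>T(_, l + k)\<close>, and
  \<open>k! ((l + k) choose k)\<close> is exactly the factor by which differentiating \<open>x\<^sup>l\<^sup>+\<^sup>k\<close> \<open>k\<close> times
  multiplies \<open>x\<^sup>l\<close>.
\<close>

text \<open>Convergence at the single nonzero point \<open>d/2\<close> already forces a positive
  radius of convergence. This carries the analytic description of T into formal power series, where
  coefficients can be compared.\<close>

lemma sums_imp_has_fps_expansion:
  fixes f :: "real \<Rightarrow> real"
  assumes "\<forall>\<^sub>F t in nhds 0. (\<lambda>n. a n * (t ^ n / fact n)) sums f t"
  shows "f has_fps_expansion Abs_fps (\<lambda>n. a n / fact n)"
proof -
  let ?F = "Abs_fps (\<lambda>n. a n / fact n)"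
  have ev: "\<forall>\<^sub>F t in nhds 0. (\<lambda>n. fps_nth ?F n * t ^ n) sums f t"
    using assms by simp
  then obtain d where d: "d > 0" "\<And>t. \<bar>t\<bar> < d \<Longrightarrow> (\<lambda>n. fps_nth ?F n * t ^ n) sums f t"
    by (auto simp: eventually_nhds_metric)
  have "0 < ereal (norm (d/2))"
    using d(1) by simp
  also have "\<dots> \<le> fps_conv_radius ?F"
    unfolding fps_conv_radius_def
    by (rule conv_radius_geI, rule sums_summable[OF d(2)]) (use d(1) in auto)
  finally have "fps_conv_radius ?F > 0" .
  moreover have "\<forall>\<^sub>F t in nhds 0. eval_fps ?F t = f t"
    using ev by eventually_elim (simp add: eval_fps_def sums_iff)
  ultimately show ?thesis by (simp add: has_fps_expansion_def)
qed

text \<open>The difference of the two expansions sums to 0 near 0, so all its coefficients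
  vanish.\<close>

lemma has_fps_expansion_unique_real:
  fixes f :: "real \<Rightarrow> real"
  assumes "f has_fps_expansion F" "f has_fps_expansion G"
  shows "F = G"
proof (rule fps_ext)
  fix n
  have *: "\<forall>\<^sub>F t in nhds 0. (\<lambda>n. fps_nth H n * t ^ n) sums f t"
    if "f has_fps_expansion H" for H
  proof -
    have "\<forall>\<^sub>F t in nhds 0. t \<in> eball 0 (fps_conv_radius H)"
      using that by (intro eventually_nhds_in_open) (auto simp: has_fps_expansion_def zero_ereal_def)
    moreover have "\<forall>\<^sub>F t in nhds 0. eval_fps H t = f t"
      using that by (simp add: has_fps_expansion_def)
    ultimately show ?thesis
      by eventually_elim (metis sums_eval_fps in_eball_iff dist_0_norm)
  qed
  have "\<forall>\<^sub>F t in nhds 0. (\<lambda>n. (fps_nth F n - fps_nth G n) * t ^ n) sums 0"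
    using *[OF assms(1)] *[OF assms(2)]
  proof eventually_elim
    case (elim t)
    from sums_diff[OF this] show ?case by (simp add: left_diff_distrib)
  qed
  from powser_sums_0_imp_coeff_0[OF this, of n] show "fps_nth F n = fps_nth G n" by simp
qed

lemma central_gf_mult:
  "central_gf M Y l t * central_gf M Y k t = real ((l + k) choose k) * central_gf M Y (l + k) t"
  by (simp add: central_gf_def binomial_fact power_add field_simps)

lemma central_fact_convolution:
  assumes "prob_space M" "Y \<in> borel_measurable M" "mgf_exists M Y r" "r > 0"
  shows "(\<Sum>j\<le>n. real (n choose j) * central_fact M Y j l * central_fact M Y (n - j) k) =
    real ((l + k) choose k) * central_fact M Y n (l + k)"
proof -
  define A where "A i = Abs_fps (\<lambda>n. central_fact M Y n i / fact n)" for i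
  have A: "central_gf M Y i has_fps_expansion A i" for i
    unfolding A_def using central_fact_generating[OF assms]
    by (intro sums_imp_has_fps_expansion) blast
  have "(\<lambda>t. central_gf M Y l t * central_gf M Y k t) has_fps_expansion A l * A k"
    by (intro has_fps_expansion_mult A)
  moreover have "(\<lambda>t. central_gf M Y l t * central_gf M Y k t) has_fps_expansion
      fps_const (real ((l + k) choose k)) * A (l + k)"
    unfolding central_gf_mult by (intro has_fps_expansion_cmult_left A)
  ultimately have "A l * A k = fps_const (real ((l + k) choose k)) * A (l + k)"
    by (rule has_fps_expansion_unique_real)
  \<comment> \<open>The factor n! turns the weights 1/(j! (n-j)!) of the Cauchy product into
    binomial coefficients.\<close>
  hence "fact n * fps_nth (A l * A k) n = fact n * (real ((l + k) choose k) * fps_nth (A (l + k)) n)"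
    by simp
  also have "\<dots> = real ((l + k) choose k) * central_fact M Y n (l + k)"
    by (simp add: A_def)
  finally show ?thesis
    unfolding fps_mult_nth
    by (simp add: A_def atLeast0AtMost sum_distrib_left binomial_fact mult_ac)
qed

text \<open>The factor k! (i choose k) is the falling factorial i(i-1)...(i-k+1). It vanishes for i
  < k, so the truncated exponent \<open>i - k\<close> does no harm there.\<close>

lemma higher_deriv_polynomial_sum:
  fixes a :: "nat \<Rightarrow> real"
  shows "(deriv ^^ k) (\<lambda>x. \<Sum>i\<le>n. a i * x ^ i) =
    (\<lambda>x. \<Sum>i\<le>n. fact k * real (i choose k) * a i * x ^ (i - k))"
proof (induction k)
  case 0
  show ?case by simp
next
  case (Suc k)
  \<comment> \<open>For i <= k both sides are 0, so truncated subtraction is again harmless.\<close>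
  have coeff: "fact k * real (i choose k) * real (i - k) = fact (Suc k) * real (i choose Suc k)" for i
  proof -
    have "(i choose k) * (i - k) = Suc k * (i choose Suc k)"
      by (metis binomial_absorb_comp binomial_absorption mult.commute)
    hence "real (i choose k) * real (i - k) = real (Suc k) * real (i choose Suc k)"
      by (metis of_nat_mult)
    thus ?thesis by simp
  qed
  have "deriv (\<lambda>x. \<Sum>i\<le>n. fact k * real (i choose k) * a i * x ^ (i - k)) x =
      (\<Sum>i\<le>n. fact (Suc k) * real (i choose Suc k) * a i * x ^ (i - Suc k))" for x :: real
  proof -
    have "((\<lambda>x. \<Sum>i\<le>n. fact k * real (i choose k) * a i * x ^ (i - k)) has_real_derivative
        (\<Sum>i\<le>n. fact k * real (i choose k) * a i * (real (i - k) * x ^ (i - Suc k)))) (at x)"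
      by (auto intro!: derivative_eq_intros sum.cong)
    moreover have "fact k * real (i choose k) * a i * (real (i - k) * x ^ (i - Suc k)) =
        fact (Suc k) * real (i choose Suc k) * a i * x ^ (i - Suc k)" for i
      using arg_cong[OF coeff[of i], of "\<lambda>c. c * a i * x ^ (i - Suc k)"] by (simp only: mult_ac)
    ultimately show ?thesis by (simp only: DERIV_imp_deriv)
  qed
  thus ?case by (simp only: Suc.IH funpow.simps o_apply)
qed

theorem theorem2p13:
  fixes M :: "'a measure" and Y :: "'a \<Rightarrow> real" and r :: real and n k :: nat and x :: real
  assumes "prob_space M"
    and "Y \<in> borel_measurable M"
    and "r > 0"
    and "mgf_exists M Y r"
    and "k \<ge> 1"
  shows "(deriv ^^ k) (\<lambda>x. central_bell M Y n x) x =
    fact k * (if n < k then 0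
      else \<Sum>j=0..n-k. real (n choose j) * central_bell M Y j x * central_fact M Y (n - j) k)"
proof -
  let ?T = "central_fact M Y"
  have T0: "?T m i = 0" if "m < i" for m i
    using central_fact_generating[OF assms(1,2,4,3)] that by blast
  \<comment> \<open>A range for l that does not depend on j allows the two sums to be swapped; the
    added terms have j < l.\<close>
  have bell: "central_bell M Y j x = (\<Sum>l\<le>n. ?T j l * x ^ l)" if "j \<le> n" for j
    unfolding central_bell_def atLeast0AtMost
    by (rule sum.mono_neutral_left) (use that T0 in auto)
  \<comment> \<open>The terms with j > n - k have n - j < k, so T(n-j, k) = 0. If n < k, this covers
    every j.\<close>
  have "(if n < k then 0 else \<Sum>j=0..n-k. real (n choose j) * central_bell M Y j x * ?T (n - j) k) =
      (\<Sum>j\<le>n. real (n choose j) * central_bell M Y j x * ?T (n - j) k)"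
    unfolding atLeast0AtMost
    by (auto simp: T0 intro!: sum.mono_neutral_left) (metis T0 diff_diff_cancel diff_le_mono2 not_le)
  also have "\<dots> = (\<Sum>j\<le>n. \<Sum>l\<le>n. real (n choose j) * (?T j l * x ^ l) * ?T (n - j) k)"
    by (simp add: bell sum_distrib_left sum_distrib_right)
  also have "\<dots> = (\<Sum>l\<le>n. x ^ l * (\<Sum>j\<le>n. real (n choose j) * ?T j l * ?T (n - j) k))"
    by (subst sum.swap) (simp add: sum_distrib_left mult_ac)
  also have "\<dots> = (\<Sum>l\<le>n. real ((l + k) choose k) * ?T n (l + k) * x ^ l)"
    by (simp only: central_fact_convolution[OF assms(1,2,4,3)]) (simp add: mult_ac)
  \<comment> \<open>Substitute i = l + k. The range then becomes i <= n: the binomial vanishes for i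
    < k, and T(n, i) for i > n.\<close>
  also have "\<dots> = (\<Sum>i\<in>{k..n+k}. real (i choose k) * ?T n i * x ^ (i - k))"
    by (rule sum.reindex_bij_witness[of _ "\<lambda>i. i - k" "\<lambda>l. l + k"]) auto
  also have "\<dots> = (\<Sum>i\<le>n+k. real (i choose k) * ?T n i * x ^ (i - k))"
    by (rule sum.mono_neutral_left) auto
  also have "\<dots> = (\<Sum>i\<le>n. real (i choose k) * ?T n i * x ^ (i - k))"
    by (rule sum.mono_neutral_right) (use T0 in auto)
  finally show ?thesis
    unfolding central_bell_def atLeast0AtMost higher_deriv_polynomial_sum
    by (simp add: sum_distrib_left mult.assoc)
qed

end
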